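(* Let $p=p(n)\in(0,1)$ satisfy $p\gg\log(n)/n$, and let $G\sim\mathbb{D}(n,p)$ be an Erdős–Rényi directed random graph. Suppose there exists $\bar\alpha\in(0,1)$ such that for all $n\in\mathbb{N}$ and every $i\in[n]$ we have $\alpha_i\le\bar\alpha$. Let $x(G,\infty)$ be the stable opinion vector of the directed opinion dynamics on $G$ and $\bar x(\infty)$ the stable solution of the corresponding mean-field dynamics. Then $$\lim_{n\to\infty}\left\|\mathbf{E}\left(x(G,\infty)\right)-\bar x(\infty)\right\|_\infty=0.$$
   Context: Notation: $[n]=\{1,\dots,n\}$; $\log$ is the natural logarithm; for $h:\mathbb{N}\to\mathbb{R}_+$, $p\gg h$ means $p(n)/h(n)\to\infty$ as $n\to\infty$. $\mathbb{D}(n,p)$ is the random simple directed graph (no loops) on node set $[n]$ in which each ordered pair $(i,j)$, $i\ne j$, is an edge independently with probability $p=p(n)$. For a directed graph $G$, $N^+(i)=\{j\in[n]:(i,j)\in E(G)\}$ and $\deg^+(i)=|N^+(i)|$. For each $n$ there are given deterministic initial opinions $x(0)\in[0,1]^n$ and values $\alpha_i\in[0,1]$, $i\in[n]$ (these data may depend on $n$; $\bar\alpha$ does not). Directed opinion dynamics: $x(G,0)=x(0)$ and, for $t\ge0$, $$x_i(G,t+1)=\begin{cases}\frac{\alpha_i}{\deg^+(i)}\sum_{j\in N^+(i)}x_j(G,t)+(1-\alpha_i)x_i(0)&\text{if }\deg^+(i)>0,\\ \alpha_ix_i(G,t)+(1-\alpha_i)x_i(0)&\text{if }\deg^+(i)=0.\end{cases}$$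 Equivalently $x(G,t+1)=H(G)x(G,t)+Bx(0)$, where $B=\mathrm{diag}(1-\alpha_1,\dots,1-\alpha_n)$ and $H_{ij}(G)=\alpha_iA_{ij}(G)/\deg^+(i)$ if $\deg^+(i)>0$, $H_{ij}(G)=\alpha_i1_{\{i=j\}}$ if $\deg^+(i)=0$, with $A(G)$ the (asymmetric) adjacency matrix ($A_{ij}(G)=1$ iff $(i,j)\in E(G)$). The stable opinion vector is $x(G,\infty)=\lim_{t\to\infty}x(G,t)$, which exists when all $\alpha_i\le\bar\alpha<1$ and equals $(I-H(G))^{-1}Bx(0)$. Mean-field dynamics: $\bar x(0)=x(0)$ and $\bar x(t+1)=\mathbf{E}(H(G))^tx(0)+\sum_{k=0}^{t-1}\mathbf{E}(H(G))^kBx(0)$, with $\mathbf{E}(H(G))$ the entrywise expectation for $G\sim\mathbb{D}(n,p)$; its stable solution is $\bar x(\infty)=\lim_{t\to\infty}\bar x(t)$, which exists when all $\alpha_i\le\bar\alpha<1$ and equals $(I-\mathbf{E}(H(G)))^{-1}Bx(0)$. *)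

theory Defs
  imports "HOL-Probability.Probability" "Jordan_Normal_Form.Matrix"
begin

unbundle no vec_syntax
hide_const (open) Finite_Cartesian_Product.vec Finite_Cartesian_Product.mat

text \<open>
  The dimension \<open>n\<close> varies, so vectors and matrices are those of Jordan_Normal_Form. These are
  indexed from 0; accordingly the node set \<open>[n]\<close> is \<open>{0..<n}\<close>. A simple directed graph on this
  node set is represented by its edge set.
\<close>

definition ordered_pairs :: "nat \<Rightarrow> (nat \<times> nat) set" where
  "ordered_pairs n = {(i, j). i < n \<and> j < n \<and> i \<noteq> j}"

text \<open>
  The second argument \<open>False\<close> of \<^const>\<open>Pi_pmf\<close> is only the default value outside the index set.
\<close>

definition random_digraph :: "nat \<Rightarrow> real \<Rightarrow> (nat \<times> nat) set pmf" where
  "random_digraph n p =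
     map_pmf (\<lambda>b. {e \<in> ordered_pairs n. b e})
       (Pi_pmf (ordered_pairs n) False (\<lambda>_. bernoulli_pmf p))"

definition out_nbrs :: "nat \<Rightarrow> (nat \<times> nat) set \<Rightarrow> nat \<Rightarrow> nat set" where
  "out_nbrs n G i = {j \<in> {0..<n}. (i, j) \<in> G}"

definition out_deg :: "nat \<Rightarrow> (nat \<times> nat) set \<Rightarrow> nat \<Rightarrow> nat" where
  "out_deg n G i = card (out_nbrs n G i)"

primrec opinion ::
    "nat \<Rightarrow> real vec \<Rightarrow> real vec \<Rightarrow> (nat \<times> nat) set \<Rightarrow> nat \<Rightarrow> real vec" where
  "opinion n \<alpha> x0 G 0 = x0"
| "opinion n \<alpha> x0 G (Suc t) = vec n (\<lambda>i.
     if out_deg n G i > 0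
     then \<alpha> $ i / real (out_deg n G i) * (\<Sum>j\<in>out_nbrs n G i. opinion n \<alpha> x0 G t $ j)
            + (1 - \<alpha> $ i) * x0 $ i
     else \<alpha> $ i * opinion n \<alpha> x0 G t $ i + (1 - \<alpha> $ i) * x0 $ i)"

definition vec_lim :: "nat \<Rightarrow> (nat \<Rightarrow> real vec) \<Rightarrow> real vec" where
  "vec_lim n x = vec n (\<lambda>i. lim (\<lambda>t. x t $ i))"

definition stable_opinion ::
    "nat \<Rightarrow> real vec \<Rightarrow> real vec \<Rightarrow> (nat \<times> nat) set \<Rightarrow> real vec" where
  "stable_opinion n \<alpha> x0 G = vec_lim n (opinion n \<alpha> x0 G)"

definition H_mat :: "nat \<Rightarrow> real vec \<Rightarrow> (nat \<times> nat) set \<Rightarrow> real mat" where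
  "H_mat n \<alpha> G = mat n n (\<lambda>(i, j).
     if out_deg n G i > 0
     then \<alpha> $ i * of_bool ((i, j) \<in> G) / real (out_deg n G i)
     else \<alpha> $ i * of_bool (i = j))"

definition B_mat :: "nat \<Rightarrow> real vec \<Rightarrow> real mat" where
  "B_mat n \<alpha> = mat_diag n (\<lambda>i. 1 - \<alpha> $ i)"

definition expected_vec :: "nat \<Rightarrow> 'a pmf \<Rightarrow> ('a \<Rightarrow> real vec) \<Rightarrow> real vec" where
  "expected_vec n M X = vec n (\<lambda>i. measure_pmf.expectation M (\<lambda>\<omega>. X \<omega> $ i))"

definition expected_mat :: "nat \<Rightarrow> 'a pmf \<Rightarrow> ('a \<Rightarrow> real mat) \<Rightarrow> real mat" where
  "expected_mat n M X =
     mat n n (\<lambda>(i, j). measure_pmf.expectation M (\<lambda>\<omega>. X \<omega> $$ (i, j)))"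

text \<open>
  In the mean-field dynamics the state at time \<open>t + 1\<close> involves powers up to \<open>t\<close> only (so that
  the states at times 0 and 1 coincide). This time shift is the one in the source; it does not
  affect the limit.
\<close>

fun mean_field :: "nat \<Rightarrow> real \<Rightarrow> real vec \<Rightarrow> real vec \<Rightarrow> nat \<Rightarrow> real vec" where
  "mean_field n p \<alpha> x0 0 = x0"
| "mean_field n p \<alpha> x0 (Suc t) =
     (let EH = expected_mat n (random_digraph n p) (H_mat n \<alpha>)
      in vec n (\<lambda>i. ((EH ^\<^sub>m t) *\<^sub>v x0) $ i
           + (\<Sum>k<t. ((EH ^\<^sub>m k) *\<^sub>v (B_mat n \<alpha> *\<^sub>v x0)) $ i)))"

definition stable_mean_field :: "nat \<Rightarrow> real \<Rightarrow> real vec \<Rightarrow> real vec \<Rightarrow> real vec" where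
  "stable_mean_field n p \<alpha> x0 = vec_lim n (mean_field n p \<alpha> x0)"

text \<open>The inserted 0 only serves to make the norm of the empty vector equal to 0.\<close>

definition linf_norm :: "real vec \<Rightarrow> real" where
  "linf_norm v = Max (insert 0 ((\<lambda>i. \<bar>v $ i\<bar>) ` {0..<dim_vec v}))"

end

(*
  With u = x(G, infinity) and m its mean-field counterpart, u - m satisfies
  (I - H(G)) (u - m) = (H(G) - E H(G)) m, and H(G) is a contraction for the maximum norm, so the
  maximum norm of u - m is at most that of (H(G) - E H(G)) m divided by 1 - alphabar. Since m is
  deterministic, the rows of H(G) m are averages of a fixed vector over random neighbourhoods. Such
  an average deviates from the mean c of m over the other nodes by at least eps only if
  the sum of (m_j - c - eps), or of (c - m_j - eps), over the neighbourhood is nonnegative; an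
  exponential moment bounds the probability of this by exp(-p (n - 1) eps^2 / 32) for each sign,
  and this event includes the empty neighbourhood. As p >> log n / n, a union bound over all n
  rows suffices.
*)
theory Submission
  imports Defs
begin

section \<open>Affine iterations with nonnegative matrices whose row sums stay below 1\<close>

lemma convergent_affine_iteration:
  fixes A :: "nat \<Rightarrow> nat \<Rightarrow> real"
  assumes nonneg: "\<And>i j. i < n \<Longrightarrow> j < n \<Longrightarrow> 0 \<le> A i j"
    and row_sum: "\<And>i. i < n \<Longrightarrow> (\<Sum>j<n. A i j) \<le> c" and c: "0 \<le> c" "c < 1"
    and step: "\<And>t i. i < n \<Longrightarrow> z (Suc t) i = (\<Sum>j<n. A i j * z t j) + b i"
    and i: "i < n"
  shows "convergent (\<lambda>t. z t i)"
proof -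
  \<comment> \<open>The sum of all first increments is a bound common to all coordinates. The affine
    term cancels in increments, so one application of \<open>A\<close> shrinks any such common bound
    by the factor \<open>c\<close>.\<close>
  define C where "C = (\<Sum>j<n. \<bar>z 1 j - z 0 j\<bar>)"
  have C: "0 \<le> C" unfolding C_def by (simp add: sum_nonneg)
  have bound: "\<bar>z (Suc t) i - z t i\<bar> \<le> C * c ^ t" if "i < n" for t i
    using that
  proof (induction t arbitrary: i)
    case 0
    have "\<bar>z 1 i - z 0 i\<bar> \<le> C"
      unfolding C_def using 0 by (intro member_le_sum) auto
    then show ?case by simp
  next
    case (Suc t)
    have "z (Suc (Suc t)) i - z (Suc t) i = (\<Sum>j<n. A i j * (z (Suc t) j - z t j))"
      using step[of i "Suc t"] step[of i t] Suc.prems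
      by (simp add: right_diff_distrib sum_subtractf)
    then have "\<bar>z (Suc (Suc t)) i - z (Suc t) i\<bar> \<le> (\<Sum>j<n. \<bar>A i j * (z (Suc t) j - z t j)\<bar>)"
      by (metis sum_abs)
    also have "\<dots> \<le> (\<Sum>j<n. A i j * (C * c ^ t))"
      using Suc nonneg by (intro sum_mono) (auto simp: abs_mult intro!: mult_left_mono)
    also have "\<dots> = (\<Sum>j<n. A i j) * (C * c ^ t)"
      by (simp add: sum_distrib_right)
    also have "\<dots> \<le> c * (C * c ^ t)"
      using row_sum Suc.prems C c by (intro mult_right_mono) auto
    finally show ?case by (simp add: mult_ac)
  qed
  \<comment> \<open>The geometric series dominates the increments, and their partial sums telescope
    to \<open>z m i - z 0 i\<close>.\<close>
  have "summable (\<lambda>t. z (Suc t) i - z t i)"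
    by (rule summable_comparison_test'[of "\<lambda>t. C * c ^ t" 0])
      (use bound i c in \<open>auto intro!: summable_mult summable_geometric\<close>)
  then have "convergent (\<lambda>m. \<Sum>t<m. z (Suc t) i - z t i)"
    by (simp add: summable_iff_convergent)
  then have "convergent (\<lambda>m. z m i - z 0 i)"
    by (simp only: sum_lessThan_telescope[of "\<lambda>t. z t i"])
  then show ?thesis
    by (simp add: convergent_diff_const_right_iff)
qed

text \<open>The equation is the recursion passed to the limit. Since \<open>a i\<close> is the exact
  row sum, the weights in row \<open>i\<close> together with \<open>1 - a i\<close> add up to 1, so
  each step is a convex combination and keeps all values in [0,1]. Both the random and the
  mean-field dynamics are instances, with \<open>a\<close> given by \<alpha>.\<close>

lemma affine_iteration_limit:
  fixes A :: "nat \<Rightarrow> nat \<Rightarrow> real"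
  assumes nonneg: "\<And>i j. i < n \<Longrightarrow> j < n \<Longrightarrow> 0 \<le> A i j"
    and row_sum: "\<And>i. i < n \<Longrightarrow> (\<Sum>j<n. A i j) = a i"
    and a: "\<And>i. i < n \<Longrightarrow> a i \<le> c" and c: "0 \<le> c" "c < 1"
    and step: "\<And>t i. i < n \<Longrightarrow> z (Suc t) i = (\<Sum>j<n. A i j * z t j) + (1 - a i) * x i"
    and x: "\<And>i. i < n \<Longrightarrow> x i \<in> {0..1}" and init: "\<And>i. i < n \<Longrightarrow> z 0 i \<in> {0..1}"
    and i: "i < n"
  shows "lim (\<lambda>t. z t i) = (\<Sum>j<n. A i j * lim (\<lambda>t. z t j)) + (1 - a i) * x i"
    and "lim (\<lambda>t. z t i) \<in> {0..1}"
proof -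
  have "convergent (\<lambda>t. z t j)" if "j < n" for j
    using nonneg row_sum a c step that
    by (intro convergent_affine_iteration[of n A c z "\<lambda>i. (1 - a i) * x i"]) auto
  then have tends: "(\<lambda>t. z t j) \<longlonglongrightarrow> lim (\<lambda>t. z t j)" if "j < n" for j
    using that by (simp add: convergent_LIMSEQ_iff)
  have "(\<lambda>t. z (Suc t) i) \<longlonglongrightarrow> (\<Sum>j<n. A i j * lim (\<lambda>t. z t j)) + (1 - a i) * x i"
    unfolding step[OF i] by (intro tendsto_intros tends) auto
  moreover have "(\<lambda>t. z (Suc t) i) \<longlonglongrightarrow> lim (\<lambda>t. z t i)"
    using tends[OF i] by (rule LIMSEQ_Suc)
  ultimately show "lim (\<lambda>t. z t i) = (\<Sum>j<n. A i j * lim (\<lambda>t. z t j)) + (1 - a i) * x i"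
    by (metis LIMSEQ_unique)
  have range: "z t i \<in> {0..1}" if "i < n" for t i
    using that
  proof (induction t arbitrary: i)
    case 0
    then show ?case by (rule init)
  next
    case (Suc t)
    have a1: "a i \<le> 1" using a[of i] c Suc.prems by simp
    have "0 \<le> z (Suc t) i"
      unfolding step[OF Suc.prems] using Suc nonneg x a1
      by (intro add_nonneg_nonneg sum_nonneg mult_nonneg_nonneg) auto
    moreover have "(\<Sum>j<n. A i j * z t j) \<le> (\<Sum>j<n. A i j * 1)"
      using Suc nonneg by (intro sum_mono mult_left_mono) auto
    moreover have "(1 - a i) * x i \<le> (1 - a i) * 1"
      using a1 x Suc.prems by (intro mult_left_mono) auto
    ultimately show ?case
      using step[OF Suc.prems, of t] row_sum[OF Suc.prems] by simp
  qed
  show "lim (\<lambda>t. z t i) \<in> {0..1}"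
    using closed_sequentially[OF closed_atLeastAtMost range[OF i] tends[OF i]] .
qed

text \<open>At a coordinate where the absolute value of \<open>d\<close> attains its maximum
  \<open>D\<close>, the residual bound gives D \<le> c * D + r. This bounds the inverse of I - A in
  the maximum norm without forming an inverse.\<close>

lemma substochastic_residual_bound:
  fixes A :: "nat \<Rightarrow> nat \<Rightarrow> real"
  assumes nonneg: "\<And>i j. i < n \<Longrightarrow> j < n \<Longrightarrow> 0 \<le> A i j"
    and row_sum: "\<And>i. i < n \<Longrightarrow> (\<Sum>j<n. A i j) \<le> c" and c: "c < 1"
    and res: "\<And>i. i < n \<Longrightarrow> \<bar>d i - (\<Sum>j<n. A i j * d j)\<bar> \<le> r"
    and i: "i < n"
  shows "\<bar>d i\<bar> \<le> r / (1 - c)"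
proof -
  define D where "D = Max ((\<lambda>j. \<bar>d j\<bar>) ` {..<n})"
  have "D \<in> (\<lambda>j. \<bar>d j\<bar>) ` {..<n}"
    unfolding D_def using i by (intro Max_in) auto
  then obtain k where k: "k < n" "D = \<bar>d k\<bar>" by auto
  have le: "\<bar>d j\<bar> \<le> D" if "j < n" for j
    unfolding D_def using that by (intro Max_ge) auto
  have "\<bar>\<Sum>j<n. A k j * d j\<bar> \<le> (\<Sum>j<n. \<bar>A k j * d j\<bar>)" by (rule sum_abs)
  also have "\<dots> \<le> (\<Sum>j<n. A k j * D)"
    using k nonneg le by (intro sum_mono) (auto simp: abs_mult intro!: mult_left_mono)
  also have "\<dots> \<le> c * D"
    using row_sum[OF k(1)] k(2) by (simp flip: sum_distrib_right add: mult_right_mono)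
  finally have "D * (1 - c) \<le> r"
    using res[OF k(1)] k(2) by (simp add: algebra_simps)
  then have "D \<le> r / (1 - c)"
    using c by (simp add: pos_le_divide_eq)
  then show ?thesis using le[OF i] by linarith
qed

section \<open>Concentration of sums over a random out-neighbourhood\<close>

lemma finite_ordered_pairs: "finite (ordered_pairs n)"
  by (rule finite_subset[of _ "{..<n} \<times> {..<n}"]) (auto simp: ordered_pairs_def)

lemma finite_set_pmf_random_digraph: "finite (set_pmf (random_digraph n p))"
  by (rule finite_subset[of _ "Pow (ordered_pairs n)"])
    (auto simp: random_digraph_def finite_ordered_pairs)

text \<open>Multiply by 1 - w: the left side becomes at most 1 because exp (- w) is at least 1 - w,
  and the right side expands to 1 + w^2 (1 - 2 w), which is at least 1 exactly because w \<le> 1/2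
  or w = 0.\<close>

lemma exp_le_quadratic:
  fixes w :: real
  assumes "w \<le> 1/2"
  shows "exp w \<le> 1 + w + 2 * w\<^sup>2"
proof -
  have "(1 - w) * exp w \<le> exp (- w) * exp w"
    using exp_ge_add_one_self[of "- w"] by (intro mult_right_mono) auto
  also have "\<dots> = 1" by (simp flip: exp_add)
  also have "1 \<le> 1 + w\<^sup>2 * (1 - 2 * w)" using assms by simp
  also have "\<dots> = (1 - w) * (1 + w + 2 * w\<^sup>2)" by (simp add: algebra_simps power2_eq_square)
  finally show ?thesis using assms by simp
qed

text \<open>The edges leaving \<open>i\<close> are independent, so the exponential moment
  factorizes. An edge to \<open>j\<close> contributes 1 + p (exp (w j) - 1), which the quadratic
  bound and 1 + x \<le> exp x turn into the stated exponent.\<close>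

lemma expectation_exp_out_nbrs_sum_le:
  fixes w :: "nat \<Rightarrow> real"
  assumes p: "0 \<le> p" "p \<le> 1" and i: "i < n" and w: "\<And>j. j < n \<Longrightarrow> w j \<le> 1/2"
  shows "measure_pmf.expectation (random_digraph n p) (\<lambda>G. exp (\<Sum>j\<in>out_nbrs n G i. w j))
    \<le> exp (p * (\<Sum>j\<in>{..<n} - {i}. w j + 2 * (w j)\<^sup>2))"
proof -
  \<comment> \<open>Pairs that do not start at \<open>i\<close> get the factor 1, so that the
    product runs over the whole index set of \<open>Pi_pmf\<close> and its product formula
    applies.\<close>
  define g where "g e b = (if fst e = i \<and> b then exp (w (snd e)) else 1)" for e :: "nat \<times> nat" and b
  \<comment> \<open>This is used twice: with \<open>P\<close> the edge indicator for the random
    neighbourhood, and with \<open>P\<close> always true for the full row in the final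
    exponent.\<close>
  have row: "{e \<in> ordered_pairs n. fst e = i \<and> P e} = Pair i ` {j \<in> {..<n} - {i}. P (i, j)}" for P
    using i by (auto simp: ordered_pairs_def)
  have exp_eq: "exp (\<Sum>j\<in>out_nbrs n {e \<in> ordered_pairs n. b e} i. w j)
    = (\<Prod>e\<in>ordered_pairs n. g e (b e))" for b
  proof -
    have "(\<Prod>e\<in>ordered_pairs n. g e (b e))
      = (\<Prod>e\<in>{e \<in> ordered_pairs n. fst e = i \<and> b e}. exp (w (snd e)))"
      unfolding g_def using finite_ordered_pairs by (simp add: prod.inter_filter)
    also have "\<dots> = (\<Prod>j\<in>{j \<in> {..<n} - {i}. b (i, j)}. exp (w j))"
      unfolding row[of b] by (subst prod.reindex) (auto simp: inj_on_def)
    also have "{j \<in> {..<n} - {i}. b (i, j)} = out_nbrs n {e \<in> ordered_pairs n. b e} i"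
      using i by (auto simp: out_nbrs_def ordered_pairs_def)
    finally show ?thesis by (simp add: exp_sum out_nbrs_def)
  qed
  have "measure_pmf.expectation (random_digraph n p) (\<lambda>G. exp (\<Sum>j\<in>out_nbrs n G i. w j))
    = measure_pmf.expectation (Pi_pmf (ordered_pairs n) False (\<lambda>_. bernoulli_pmf p))
        (\<lambda>b. \<Prod>e\<in>ordered_pairs n. g e (b e))"
    by (simp add: random_digraph_def exp_eq)
  also have "\<dots> = (\<Prod>e\<in>ordered_pairs n. measure_pmf.expectation (bernoulli_pmf p) (g e))"
    by (rule expectation_prod_Pi_pmf)
      (auto simp: finite_ordered_pairs g_def intro!: integrable_measure_pmf_finite)
  also have "\<dots> \<le> (\<Prod>e\<in>ordered_pairs n.
      exp (if fst e = i then p * (w (snd e) + 2 * (w (snd e))\<^sup>2) else 0))"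
  proof (rule prod_mono, safe)
    fix a b assume "(a, b) \<in> ordered_pairs n"
    then have b: "w b \<le> 1/2" using w by (auto simp: ordered_pairs_def)
    show "0 \<le> measure_pmf.expectation (bernoulli_pmf p) (g (a, b))"
      using p by (auto simp: g_def)
    show "measure_pmf.expectation (bernoulli_pmf p) (g (a, b))
      \<le> exp (if fst (a, b) = i then p * (w (snd (a, b)) + 2 * (w (snd (a, b)))\<^sup>2) else 0)"
    proof (cases "a = i")
      case True
      have "p * exp (w b) \<le> p * (1 + w b + 2 * (w b)\<^sup>2)"
        using exp_le_quadratic[OF b] p by (intro mult_left_mono) auto
      then have "exp (w b) * p + (1 - p) \<le> 1 + p * (w b + 2 * (w b)\<^sup>2)"
        by (simp add: algebra_simps)
      also have "\<dots> \<le> exp (p * (w b + 2 * (w b)\<^sup>2))" by (rule exp_ge_add_one_self)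
      finally show ?thesis using p True by (simp add: g_def)
    qed (use p in \<open>simp add: g_def\<close>)
  qed
  also have "\<dots> = exp (\<Sum>e\<in>ordered_pairs n.
      if fst e = i then p * (w (snd e) + 2 * (w (snd e))\<^sup>2) else 0)"
    by (simp add: exp_sum finite_ordered_pairs)
  also have "(\<Sum>e\<in>ordered_pairs n. if fst e = i then p * (w (snd e) + 2 * (w (snd e))\<^sup>2) else 0)
    = (\<Sum>e\<in>{e \<in> ordered_pairs n. fst e = i \<and> True}. p * (w (snd e) + 2 * (w (snd e))\<^sup>2))"
    using finite_ordered_pairs by (simp add: sum.inter_filter)
  also have "\<dots> = (\<Sum>j\<in>{..<n} - {i}. p * (w j + 2 * (w j)\<^sup>2))"
    unfolding row[of "\<lambda>_. True"] by (subst sum.reindex) (auto simp: inj_on_def intro!: sum.cong)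
  finally show ?thesis by (simp add: sum_distrib_left)
qed

text \<open>Chernoff's argument: on the event the exponential is at least 1, so it dominates the
  indicator.\<close>

lemma prob_out_nbrs_sum_nonneg_le:
  fixes w :: "nat \<Rightarrow> real"
  assumes "0 \<le> p" "p \<le> 1" "i < n" "\<And>j. j < n \<Longrightarrow> w j \<le> 1/2"
  shows "measure_pmf.prob (random_digraph n p) {G. 0 \<le> (\<Sum>j\<in>out_nbrs n G i. w j)}
    \<le> exp (p * (\<Sum>j\<in>{..<n} - {i}. w j + 2 * (w j)\<^sup>2))"
proof -
  let ?M = "random_digraph n p"
  have "measure_pmf.prob ?M {G. 0 \<le> (\<Sum>j\<in>out_nbrs n G i. w j)}
    = measure_pmf.expectation ?M (indicator {G. 0 \<le> (\<Sum>j\<in>out_nbrs n G i. w j)})"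
    by simp
  also have "\<dots> \<le> measure_pmf.expectation ?M (\<lambda>G. exp (\<Sum>j\<in>out_nbrs n G i. w j))"
    by (intro integral_mono integrable_measure_pmf_finite finite_set_pmf_random_digraph)
      (auto simp: indicator_def)
  also have "\<dots> \<le> exp (p * (\<Sum>j\<in>{..<n} - {i}. w j + 2 * (w j)\<^sup>2))"
    using assms by (rule expectation_exp_out_nbrs_sum_le)
  finally show ?thesis .
qed

text \<open>Multiplying \<epsilon> by the degree instead of dividing the sum keeps the random
  denominator out of the estimate. The event then becomes nonnegativity of a single sum, and it
  holds for every empty neighbourhood.\<close>

lemma prob_out_nbrs_centered_sum_ge:
  fixes c :: "nat \<Rightarrow> real"
  assumes p: "0 \<le> p" "p \<le> 1" and i: "i < n" and \<epsilon>: "0 < \<epsilon>" "\<epsilon> \<le> 1"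
    and c: "\<And>j. j < n \<Longrightarrow> \<bar>c j\<bar> \<le> 1" and centered: "(\<Sum>j\<in>{..<n} - {i}. c j) = 0"
  shows "measure_pmf.prob (random_digraph n p)
      {G. \<epsilon> * real (out_deg n G i) \<le> (\<Sum>j\<in>out_nbrs n G i. c j)}
    \<le> exp (- (p * real (n - 1) * \<epsilon>\<^sup>2 / 32))"
proof -
  \<comment> \<open>The scale \<epsilon>/16 balances drift against variance: centering leaves an
    average drift of -\<epsilon>^2/16 per node, while |c j - \<epsilon>| \<le> 2 limits the
    quadratic term to \<epsilon>^2/32. A net -\<epsilon>^2/32 per node remains.\<close>
  define w where "w j = \<epsilon> / 16 * (c j - \<epsilon>)" for j
  have sum_w: "(\<Sum>j\<in>out_nbrs n G i. w j)
    = \<epsilon> / 16 * ((\<Sum>j\<in>out_nbrs n G i. c j) - \<epsilon> * real (out_deg n G i))" for G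
    unfolding w_def sum_distrib_left[symmetric] by (simp add: out_deg_def sum_subtractf)
  have w_le: "w j \<le> 1/2" if "j < n" for j
  proof -
    have "w j \<le> \<epsilon> / 16 * 1"
      unfolding w_def using c[OF that] \<epsilon> by (intro mult_left_mono) auto
    then show ?thesis using \<epsilon> by simp
  qed
  have w_sq: "2 * (w j)\<^sup>2 \<le> \<epsilon>\<^sup>2 / 32" if "j < n" for j
  proof -
    have "\<bar>c j - \<epsilon>\<bar> \<le> 2" using c[OF that] \<epsilon> by linarith
    then have "(c j - \<epsilon>)\<^sup>2 \<le> 2\<^sup>2" by (metis abs_ge_zero power2_abs power_mono)
    then have "\<epsilon>\<^sup>2 / 128 * (c j - \<epsilon>)\<^sup>2 \<le> \<epsilon>\<^sup>2 / 128 * 4" by (intro mult_left_mono) auto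
    then show ?thesis by (simp add: w_def power_mult_distrib power_divide)
  qed
  have "(\<Sum>j\<in>{..<n} - {i}. w j + 2 * (w j)\<^sup>2)
    \<le> (\<Sum>j\<in>{..<n} - {i}. \<epsilon> / 16 * c j - \<epsilon>\<^sup>2 / 32)"
  proof (rule sum_mono)
    fix j assume "j \<in> {..<n} - {i}"
    moreover have "w j = \<epsilon> / 16 * c j - \<epsilon>\<^sup>2 / 16"
      by (simp add: w_def field_simps power2_eq_square)
    ultimately show "w j + 2 * (w j)\<^sup>2 \<le> \<epsilon> / 16 * c j - \<epsilon>\<^sup>2 / 32"
      using w_sq[of j] by simp
  qed
  also have "\<dots> = - (real (n - 1) * \<epsilon>\<^sup>2 / 32)"
    unfolding sum_subtractf sum_distrib_left[symmetric] centered using i by simp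
  finally have "p * (\<Sum>j\<in>{..<n} - {i}. w j + 2 * (w j)\<^sup>2) \<le> p * - (real (n - 1) * \<epsilon>\<^sup>2 / 32)"
    using p(1) by (rule mult_left_mono)
  then have exp_le: "exp (p * (\<Sum>j\<in>{..<n} - {i}. w j + 2 * (w j)\<^sup>2))
      \<le> exp (- (p * real (n - 1) * \<epsilon>\<^sup>2 / 32))"
    by (simp add: mult.assoc)
  have "{G. \<epsilon> * real (out_deg n G i) \<le> (\<Sum>j\<in>out_nbrs n G i. c j)}
    = {G. 0 \<le> (\<Sum>j\<in>out_nbrs n G i. w j)}"
    unfolding sum_w using \<epsilon> by (simp add: zero_le_mult_iff)
  then show ?thesis
    using order.trans[OF prob_out_nbrs_sum_nonneg_le[of p i n w, OF p i w_le] exp_le] by simp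
qed

lemma prob_out_nbrs_deviation_le:
  fixes y :: "nat \<Rightarrow> real"
  assumes p: "0 \<le> p" "p \<le> 1" and i: "i < n" and n: "2 \<le> n" and \<epsilon>: "0 < \<epsilon>" "\<epsilon> \<le> 1"
    and y: "\<And>j. j < n \<Longrightarrow> y j \<in> {0..1}"
  defines "\<mu> \<equiv> (\<Sum>j\<in>{..<n} - {i}. y j) / real (n - 1)"
  shows "measure_pmf.prob (random_digraph n p)
      {G. \<epsilon> * real (out_deg n G i) \<le> \<bar>\<Sum>j\<in>out_nbrs n G i. y j - \<mu>\<bar>}
    \<le> 2 * exp (- (p * real (n - 1) * \<epsilon>\<^sup>2 / 32))"
proof -
  let ?M = "random_digraph n p"
  \<comment> \<open>The sign \<sigma> treats both tails at once. As the values and their mean \<mu>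
    lie in [0,1], the centred values are bounded by 1 for either sign.\<close>
  let ?E = "\<lambda>\<sigma>. {G. \<epsilon> * real (out_deg n G i) \<le> (\<Sum>j\<in>out_nbrs n G i. \<sigma> * (y j - \<mu>))}"
  have "(\<Sum>j\<in>{..<n} - {i}. y j) \<le> (\<Sum>j\<in>{..<n} - {i}. 1)"
    using y by (intro sum_mono) auto
  then have "(\<Sum>j\<in>{..<n} - {i}. y j) \<le> real (n - 1)" using i by simp
  moreover have "0 \<le> (\<Sum>j\<in>{..<n} - {i}. y j)" using y by (intro sum_nonneg) auto
  ultimately have \<mu>: "0 \<le> \<mu>" "\<mu> \<le> 1"
    using n unfolding \<mu>_def by (auto simp: divide_le_eq)
  have "(\<Sum>j\<in>{..<n} - {i}. y j - \<mu>) = 0"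
    using i n by (simp add: sum_subtractf \<mu>_def)
  then have centered: "(\<Sum>j\<in>{..<n} - {i}. \<sigma> * (y j - \<mu>)) = 0" for \<sigma>
    by (simp flip: sum_distrib_left)
  have bound: "measure_pmf.prob ?M (?E \<sigma>) \<le> exp (- (p * real (n - 1) * \<epsilon>\<^sup>2 / 32))"
    if "\<bar>\<sigma>\<bar> = 1" for \<sigma>
  proof (rule prob_out_nbrs_centered_sum_ge[OF p i \<epsilon> _ centered])
    fix j assume "j < n"
    then have "y j \<in> {0..1}" by (rule y)
    then show "\<bar>\<sigma> * (y j - \<mu>)\<bar> \<le> 1" using that \<mu> by (auto simp: abs_mult)
  qed
  have "{G. \<epsilon> * real (out_deg n G i) \<le> \<bar>\<Sum>j\<in>out_nbrs n G i. y j - \<mu>\<bar>} \<subseteq> ?E 1 \<union> ?E (-1)"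
    unfolding sum_distrib_left[symmetric] by auto
  then have "measure_pmf.prob ?M {G. \<epsilon> * real (out_deg n G i) \<le> \<bar>\<Sum>j\<in>out_nbrs n G i. y j - \<mu>\<bar>}
    \<le> measure_pmf.prob ?M (?E 1 \<union> ?E (-1))"
    by (intro measure_pmf.finite_measure_mono) auto
  also have "\<dots> \<le> measure_pmf.prob ?M (?E 1) + measure_pmf.prob ?M (?E (-1))"
    by (rule measure_Un_le) auto
  also have "\<dots> \<le> 2 * exp (- (p * real (n - 1) * \<epsilon>\<^sup>2 / 32))"
    using bound[of 1] bound[of "-1"] by simp
  finally show ?thesis .
qed

section \<open>The opinion matrix, its expectation, and the two recursions\<close>

lemma H_mat_nonneg: "0 \<le> \<alpha> $ i \<Longrightarrow> i < n \<Longrightarrow> j < n \<Longrightarrow> 0 \<le> H_mat n \<alpha> G $$ (i, j)"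
  by (simp add: H_mat_def)

text \<open>Keeping \<open>v\<close> arbitrary serves the row sums (v = 1), the opinion recursion,
  and later the random row averages of the mean-field solution.\<close>

lemma H_mat_row:
  assumes "i < n"
  shows "(\<Sum>j<n. H_mat n \<alpha> G $$ (i, j) * v j) =
    (if out_deg n G i > 0 then \<alpha> $ i / real (out_deg n G i) * (\<Sum>j\<in>out_nbrs n G i. v j)
     else \<alpha> $ i * v i)"
proof (cases "out_deg n G i > 0")
  case True
  have "(\<Sum>j\<in>out_nbrs n G i. v j) = (\<Sum>j<n. of_bool ((i, j) \<in> G) * v j)"
    unfolding out_nbrs_def atLeast0LessThan sum.inter_filter[OF finite_lessThan]
    by (intro sum.cong) auto
  moreover have "(\<Sum>j<n. H_mat n \<alpha> G $$ (i, j) * v j)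
    = (\<Sum>j<n. \<alpha> $ i / real (out_deg n G i) * (of_bool ((i, j) \<in> G) * v j))"
    using True assms by (intro sum.cong) (auto simp: H_mat_def)
  ultimately show ?thesis
    using True by (simp only: sum_distrib_left[symmetric] if_True)
next
  case False
  have "(\<Sum>j<n. H_mat n \<alpha> G $$ (i, j) * v j) = (\<Sum>j<n. if i = j then \<alpha> $ i * v j else 0)"
    using False assms by (intro sum.cong) (auto simp: H_mat_def)
  then show ?thesis using False assms by simp
qed

lemma H_mat_row_sum: "i < n \<Longrightarrow> (\<Sum>j<n. H_mat n \<alpha> G $$ (i, j)) = \<alpha> $ i"
  using H_mat_row[of i n \<alpha> G "\<lambda>_. 1"] by (simp add: out_deg_def)

lemma opinion_Suc:
  "i < n \<Longrightarrow> opinion n \<alpha> x0 G (Suc t) $ i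
    = (\<Sum>j<n. H_mat n \<alpha> G $$ (i, j) * opinion n \<alpha> x0 G t $ j) + (1 - \<alpha> $ i) * x0 $ i"
  by (simp add: H_mat_row)

text \<open>The recursion of \<open>pow_mat\<close> adds the new factor on the right, whereas the
  dynamics applies the matrix last, on the left. The induction generalizes \<open>v\<close> because
  one factor is absorbed into the vector.\<close>

lemma pow_mat_Suc_mult_vec:
  fixes A :: "'a :: comm_ring_1 mat"
  assumes A: "A \<in> carrier_mat n n" and v: "v \<in> carrier_vec n"
  shows "A ^\<^sub>m Suc k *\<^sub>v v = A *\<^sub>v (A ^\<^sub>m k *\<^sub>v v)"
  using v
proof (induction k arbitrary: v)
  case 0
  then show ?case using A by simp
next
  case (Suc k)
  have pow: "A ^\<^sub>m Suc m *\<^sub>v v = A ^\<^sub>m m *\<^sub>v (A *\<^sub>v v)" for m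
    using A Suc.prems by (simp add: assoc_mult_mat_vec[of _ n n _ n] pow_carrier_mat)
  have "A ^\<^sub>m Suc (Suc k) *\<^sub>v v = A ^\<^sub>m Suc k *\<^sub>v (A *\<^sub>v v)"
    by (rule pow)
  also have "\<dots> = A *\<^sub>v (A ^\<^sub>m k *\<^sub>v (A *\<^sub>v v))"
    using A Suc by (intro Suc.IH) auto
  also have "A ^\<^sub>m k *\<^sub>v (A *\<^sub>v v) = A ^\<^sub>m Suc k *\<^sub>v v"
    by (rule pow[symmetric])
  finally show ?case .
qed

lemma mult_mat_vec_nth:
  "A \<in> carrier_mat n n \<Longrightarrow> v \<in> carrier_vec n \<Longrightarrow> i < n \<Longrightarrow>
    (A *\<^sub>v v) $ i = (\<Sum>j<n. A $$ (i, j) * v $ j)"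
  by (auto simp: scalar_prod_def atLeast0LessThan intro!: sum.cong)

text \<open>Factoring the matrix out of the power sums recovers an affine recursion. It starts at
  time 1, because the step from time 0 to time 1 leaves the state unchanged.\<close>

lemma mean_field_Suc_Suc:
  assumes x0: "x0 \<in> carrier_vec n" and i: "i < n"
  shows "mean_field n p \<alpha> x0 (Suc (Suc t)) $ i
    = (\<Sum>j<n. expected_mat n (random_digraph n p) (H_mat n \<alpha>) $$ (i, j) * mean_field n p \<alpha> x0 (Suc t) $ j)
      + (1 - \<alpha> $ i) * x0 $ i"
proof -
  define E where "E = expected_mat n (random_digraph n p) (H_mat n \<alpha>)"
  define b where "b = B_mat n \<alpha> *\<^sub>v x0"
  have E: "E \<in> carrier_mat n n" by (simp add: E_def expected_mat_def)
  have b: "b \<in> carrier_vec n" 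
    unfolding b_def B_mat_def by (rule mult_mat_vec_carrier[OF _ x0]) (simp add: mat_diag_def)
  have pow_Suc: "(E ^\<^sub>m Suc k *\<^sub>v v) $ i = (\<Sum>j<n. E $$ (i, j) * (E ^\<^sub>m k *\<^sub>v v) $ j)"
    if "v \<in> carrier_vec n" for k v
    unfolding pow_mat_Suc_mult_vec[OF E that]
    by (rule mult_mat_vec_nth[OF E mult_mat_vec_carrier[OF pow_carrier_mat[OF E] that] i])
  have "(E ^\<^sub>m 0 *\<^sub>v b) $ i = (1 - \<alpha> $ i) * x0 $ i"
  proof -
    have "(E ^\<^sub>m 0 *\<^sub>v b) $ i = b $ i" using E b by simp
    also have "\<dots> = (\<Sum>j<n. B_mat n \<alpha> $$ (i, j) * x0 $ j)"
      unfolding b_def using x0 i by (intro mult_mat_vec_nth) (auto simp: B_mat_def)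
    also have "\<dots> = (\<Sum>j<n. if j = i then (1 - \<alpha> $ i) * x0 $ j else 0)"
      using i by (intro sum.cong) (auto simp: B_mat_def mat_diag_def)
    finally show ?thesis using i by simp
  qed
  \<comment> \<open>The term k = 0 is split off as the affine part; every other power has a matrix
    factor to extract.\<close>
  then have "(\<Sum>k<Suc t. (E ^\<^sub>m k *\<^sub>v b) $ i)
    = (\<Sum>k<t. \<Sum>j<n. E $$ (i, j) * (E ^\<^sub>m k *\<^sub>v b) $ j) + (1 - \<alpha> $ i) * x0 $ i"
    by (simp only: sum.lessThan_Suc_shift pow_Suc[OF b] add.commute)
  also have "(\<Sum>k<t. \<Sum>j<n. E $$ (i, j) * (E ^\<^sub>m k *\<^sub>v b) $ j)
    = (\<Sum>j<n. E $$ (i, j) * (\<Sum>k<t. (E ^\<^sub>m k *\<^sub>v b) $ j))"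
    by (subst sum.swap) (simp add: sum_distrib_left)
  finally show ?thesis
    using i by (simp only: mean_field.simps Let_def flip: E_def b_def)
      (simp add: pow_Suc[OF x0] distrib_left sum.distrib del: sum.lessThan_Suc pow_mat.simps)
qed

text \<open>By linearity, the averaged matrix applied to a deterministic vector is the mean of a
  random row average, the quantity to which the concentration bound applies.\<close>

lemma expected_H_mat_row:
  assumes "i < n"
  shows "(\<Sum>j<n. expected_mat n (random_digraph n p) (H_mat n \<alpha>) $$ (i, j) * v j)
    = measure_pmf.expectation (random_digraph n p) (\<lambda>G. \<Sum>j<n. H_mat n \<alpha> G $$ (i, j) * v j)"
  using assms
  by (subst Bochner_Integration.integral_sum)
    (auto simp: expected_mat_def intro!: integrable_measure_pmf_finite finite_set_pmf_random_digraph)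

lemma expected_H_mat_nonneg:
  "0 \<le> \<alpha> $ i \<Longrightarrow> i < n \<Longrightarrow> j < n \<Longrightarrow> 0 \<le> expected_mat n (random_digraph n p) (H_mat n \<alpha>) $$ (i, j)"
  by (auto simp: expected_mat_def H_mat_nonneg intro!: integral_nonneg_AE)

lemma expected_H_mat_row_sum:
  "i < n \<Longrightarrow> (\<Sum>j<n. expected_mat n (random_digraph n p) (H_mat n \<alpha>) $$ (i, j)) = \<alpha> $ i"
  using expected_H_mat_row[of i n p \<alpha> "\<lambda>_. 1"] by (simp add: H_mat_row_sum)

section \<open>Fixed-point equations and comparison of the two stable vectors\<close>

lemma abs_expectation_diff_le:
  fixes f :: "'a \<Rightarrow> real"
  assumes fin: "finite (set_pmf M)" and \<epsilon>: "0 \<le> \<epsilon>"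
    and good: "\<And>x. x \<notin> S \<Longrightarrow> \<bar>f x - a\<bar> \<le> \<epsilon>" and all: "\<And>x. \<bar>f x - a\<bar> \<le> 1"
  shows "\<bar>measure_pmf.expectation M f - a\<bar> \<le> \<epsilon> + measure_pmf.prob M S"
proof -
  note int = integrable_measure_pmf_finite[OF fin]
  have "\<bar>measure_pmf.expectation M f - a\<bar> = \<bar>measure_pmf.expectation M (\<lambda>x. f x - a)\<bar>"
    by (simp add: Bochner_Integration.integral_diff int)
  also have "\<dots> \<le> measure_pmf.expectation M (\<lambda>x. \<bar>f x - a\<bar>)"
    by (rule integral_abs_bound)
  \<comment> \<open>Off \<open>S\<close> the error is at most \<epsilon>; on the bad set the trivial
    bound 1 is paid.\<close>
  also have "\<dots> \<le> measure_pmf.expectation M (\<lambda>x. \<epsilon> + indicator S x)"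
  proof (rule integral_mono[OF int int])
    show "\<bar>f x - a\<bar> \<le> \<epsilon> + indicator S x" for x
      using good[of x] all[of x] \<epsilon> by (cases "x \<in> S") auto
  qed
  also have "\<dots> = \<epsilon> + measure_pmf.prob M S"
    using int[of "indicator S :: 'a \<Rightarrow> real"] by simp
  finally show ?thesis .
qed


lemma stable_opinion_fixed_point:
  assumes \<alpha>: "\<And>i. i < n \<Longrightarrow> 0 \<le> \<alpha> $ i" "\<And>i. i < n \<Longrightarrow> \<alpha> $ i \<le> c" and c: "0 \<le> c" "c < 1"
    and x0: "\<And>i. i < n \<Longrightarrow> x0 $ i \<in> {0..1}" and i: "i < n"
  shows "stable_opinion n \<alpha> x0 G $ i
      = (\<Sum>j<n. H_mat n \<alpha> G $$ (i, j) * stable_opinion n \<alpha> x0 G $ j) + (1 - \<alpha> $ i) * x0 $ i"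
    and "stable_opinion n \<alpha> x0 G $ i \<in> {0..1}"
proof -
  have lim: "stable_opinion n \<alpha> x0 G $ j = lim (\<lambda>t. opinion n \<alpha> x0 G t $ j)" if "j < n" for j
    using that by (simp add: stable_opinion_def vec_lim_def)
  note limit = affine_iteration_limit[where A = "\<lambda>i j. H_mat n \<alpha> G $$ (i, j)" and a = "\<lambda>i. \<alpha> $ i"
      and z = "\<lambda>t i. opinion n \<alpha> x0 G t $ i" and x = "\<lambda>i. x0 $ i",
      OF H_mat_nonneg[OF \<alpha>(1)] H_mat_row_sum \<alpha>(2) c opinion_Suc x0 _ i]
  show "stable_opinion n \<alpha> x0 G $ i \<in> {0..1}"
    unfolding lim[OF i] by (rule limit(2)) (use x0 in auto)
  have "(\<Sum>j<n. H_mat n \<alpha> G $$ (i, j) * stable_opinion n \<alpha> x0 G $ j)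
    = (\<Sum>j<n. H_mat n \<alpha> G $$ (i, j) * lim (\<lambda>t. opinion n \<alpha> x0 G t $ j))"
    by (simp add: lim)
  then show "stable_opinion n \<alpha> x0 G $ i
      = (\<Sum>j<n. H_mat n \<alpha> G $$ (i, j) * stable_opinion n \<alpha> x0 G $ j) + (1 - \<alpha> $ i) * x0 $ i"
    unfolding lim[OF i] by (simp only:) (rule limit(1), use x0 in auto)
qed

lemma stable_mean_field_fixed_point:
  assumes \<alpha>: "\<And>i. i < n \<Longrightarrow> 0 \<le> \<alpha> $ i" "\<And>i. i < n \<Longrightarrow> \<alpha> $ i \<le> c" and c: "0 \<le> c" "c < 1"
    and x0_dim: "x0 \<in> carrier_vec n" and x0: "\<And>i. i < n \<Longrightarrow> x0 $ i \<in> {0..1}" and i: "i < n"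
  shows "stable_mean_field n p \<alpha> x0 $ i
      = measure_pmf.expectation (random_digraph n p)
          (\<lambda>G. \<Sum>j<n. H_mat n \<alpha> G $$ (i, j) * stable_mean_field n p \<alpha> x0 $ j)
        + (1 - \<alpha> $ i) * x0 $ i"
    and "stable_mean_field n p \<alpha> x0 $ i \<in> {0..1}"
proof -
  let ?E = "expected_mat n (random_digraph n p) (H_mat n \<alpha>)"
  \<comment> \<open>The limit is taken along the shifted sequence because the recursion holds only
    from time 1 on.\<close>
  have lim: "stable_mean_field n p \<alpha> x0 $ j = lim (\<lambda>t. mean_field n p \<alpha> x0 (Suc t) $ j)"
    if "j < n" for j
    using that filterlim_sequentially_Suc[of "\<lambda>t. mean_field n p \<alpha> x0 t $ j"]
    by (simp only: stable_mean_field_def vec_lim_def index_vec lim_def)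
  \<comment> \<open>At time 1 the power is the identity and the sum is empty, so the state is still
    \<open>x0\<close>.\<close>
  have init: "mean_field n p \<alpha> x0 (Suc 0) $ j \<in> {0..1}" if "j < n" for j
  proof -
    have "dim_row ?E = n" by (simp add: expected_mat_def)
    then show ?thesis using x0[OF that] x0_dim that by (simp add: Let_def)
  qed
  note limit = affine_iteration_limit[where A = "\<lambda>i j. ?E $$ (i, j)" and a = "\<lambda>i. \<alpha> $ i"
      and z = "\<lambda>t i. mean_field n p \<alpha> x0 (Suc t) $ i" and x = "\<lambda>i. x0 $ i",
      OF expected_H_mat_nonneg[OF \<alpha>(1)] expected_H_mat_row_sum \<alpha>(2) c
        mean_field_Suc_Suc[OF x0_dim] x0 init i]
  show "stable_mean_field n p \<alpha> x0 $ i \<in> {0..1}"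
    unfolding lim[OF i] by (rule limit(2)) auto
  have "stable_mean_field n p \<alpha> x0 $ i
    = (\<Sum>j<n. ?E $$ (i, j) * lim (\<lambda>t. mean_field n p \<alpha> x0 (Suc t) $ j)) + (1 - \<alpha> $ i) * x0 $ i"
    unfolding lim[OF i] by (rule limit(1)) auto
  also have "(\<Sum>j<n. ?E $$ (i, j) * lim (\<lambda>t. mean_field n p \<alpha> x0 (Suc t) $ j))
    = (\<Sum>j<n. ?E $$ (i, j) * stable_mean_field n p \<alpha> x0 $ j)"
    using lim by (intro sum.cong) auto
  finally show "stable_mean_field n p \<alpha> x0 $ i
      = measure_pmf.expectation (random_digraph n p)
          (\<lambda>G. \<Sum>j<n. H_mat n \<alpha> G $$ (i, j) * stable_mean_field n p \<alpha> x0 $ j)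
        + (1 - \<alpha> $ i) * x0 $ i"
    unfolding expected_H_mat_row[OF i] .
qed

lemma H_mat_row_mean_in_range:
  assumes "0 \<le> \<alpha> $ i" and "i < n" and v: "\<And>j. j < n \<Longrightarrow> v j \<in> {0..1}"
  shows "(\<Sum>j<n. H_mat n \<alpha> G $$ (i, j) * v j) \<in> {0..\<alpha> $ i}"
proof -
  have "(\<Sum>j<n. H_mat n \<alpha> G $$ (i, j) * v j) \<le> (\<Sum>j<n. H_mat n \<alpha> G $$ (i, j) * 1)"
    using assms H_mat_nonneg by (intro sum_mono mult_left_mono) auto
  moreover have "0 \<le> (\<Sum>j<n. H_mat n \<alpha> G $$ (i, j) * v j)"
    using assms H_mat_nonneg by (intro sum_nonneg mult_nonneg_nonneg) auto
  ultimately show ?thesis using H_mat_row_sum[OF assms(2)] by simp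
qed

text \<open>The first summand bounds the error on graphs in which every row average is typical,
  through the residual estimate; the second is the union bound for the remaining graphs, where the
  error is at most 1.\<close>

lemma expected_stable_opinion_close:
  assumes n: "2 \<le> n" and p: "0 \<le> p" "p \<le> 1" and \<epsilon>: "0 < \<epsilon>" "\<epsilon> \<le> 1"
    and \<alpha>: "\<And>i. i < n \<Longrightarrow> 0 \<le> \<alpha> $ i" "\<And>i. i < n \<Longrightarrow> \<alpha> $ i \<le> c" and c: "0 \<le> c" "c < 1"
    and x0_dim: "x0 \<in> carrier_vec n" and x0: "\<And>i. i < n \<Longrightarrow> x0 $ i \<in> {0..1}" and i: "i < n"
  defines "\<delta> \<equiv> 2 * exp (- (p * real (n - 1) * \<epsilon>\<^sup>2 / 32))"
  shows "\<bar>measure_pmf.expectation (random_digraph n p) (\<lambda>G. stable_opinion n \<alpha> x0 G $ i)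
      - stable_mean_field n p \<alpha> x0 $ i\<bar> \<le> (2 * \<epsilon> + \<delta>) / (1 - c) + real n * \<delta>"
proof -
  let ?M = "random_digraph n p"
  define m where "m j = stable_mean_field n p \<alpha> x0 $ j" for j
  define u where "u G j = stable_opinion n \<alpha> x0 G $ j" for G j
  define h where "h k G = (\<Sum>j<n. H_mat n \<alpha> G $$ (k, j) * m j)" for k G
  define \<mu> where "\<mu> k = (\<Sum>j\<in>{..<n} - {k}. m j) / real (n - 1)" for k
  define S where "S k = {G. \<epsilon> * real (out_deg n G k) \<le> \<bar>\<Sum>j\<in>out_nbrs n G k. m j - \<mu> k\<bar>}" for k
  have m: "m j \<in> {0..1}" if "j < n" for j
    unfolding m_def using stable_mean_field_fixed_point(2)[OF \<alpha> c x0_dim x0 that] by simp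
  have m_eq: "m k = measure_pmf.expectation ?M (h k) + (1 - \<alpha> $ k) * x0 $ k" if "k < n" for k
    unfolding m_def h_def by (rule stable_mean_field_fixed_point(1)[OF \<alpha> c x0_dim x0 that])
  have u: "u G k \<in> {0..1}"
    and u_eq: "u G k = (\<Sum>j<n. H_mat n \<alpha> G $$ (k, j) * u G j) + (1 - \<alpha> $ k) * x0 $ k"
    if "k < n" for G k
    unfolding u_def using stable_opinion_fixed_point[OF \<alpha> c x0 that] by auto
  have prob_S: "measure_pmf.prob ?M (S k) \<le> \<delta>" if "k < n" for k
    unfolding S_def \<mu>_def \<delta>_def by (rule prob_out_nbrs_deviation_le[OF p that n \<epsilon> m])
  \<comment> \<open>The deterministic value \<open>\<alpha> $ k * \<mu> k\<close> serves as an
    intermediary: a typical row average lies within \<epsilon> of it, and its expectation within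
    \<epsilon> + \<delta>, which together give the residual 2 \<epsilon> + \<delta>.\<close>
  have h_good: "\<bar>h k G - \<alpha> $ k * \<mu> k\<bar> \<le> \<epsilon>" if k: "k < n" and G: "G \<notin> S k" for k G
  proof -
    have dev: "\<bar>\<Sum>j\<in>out_nbrs n G k. m j - \<mu> k\<bar> < \<epsilon> * real (out_deg n G k)"
      using G by (simp add: S_def)
    \<comment> \<open>Strictness of the inequality excludes degree 0, where both sides would
      vanish.\<close>
    then have deg: "0 < out_deg n G k" by (cases "out_deg n G k") auto
    have centered: "(\<Sum>j\<in>out_nbrs n G k. m j - \<mu> k)
        = (\<Sum>j\<in>out_nbrs n G k. m j) - real (out_deg n G k) * \<mu> k"
      by (simp add: sum_subtractf out_deg_def)
    have "h k G - \<alpha> $ k * \<mu> k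
        = \<alpha> $ k * ((\<Sum>j\<in>out_nbrs n G k. m j - \<mu> k) / real (out_deg n G k))"
      unfolding h_def H_mat_row[OF k] centered using deg by (simp add: field_simps)
    also have "\<bar>\<dots>\<bar> \<le> 1 * \<epsilon>"
      unfolding abs_mult using dev deg \<alpha>[OF k] c \<epsilon>
      by (intro mult_mono) (auto simp: abs_divide divide_le_eq)
    finally show ?thesis by simp
  qed
  have h_all: "\<bar>h k G - \<alpha> $ k * \<mu> k\<bar> \<le> 1" if k: "k < n" for k G
  proof -
    have "(\<Sum>j\<in>{..<n} - {k}. m j) \<le> (\<Sum>j\<in>{..<n} - {k}. 1)"
      using m by (intro sum_mono) auto
    moreover have "0 \<le> (\<Sum>j\<in>{..<n} - {k}. m j)" using m by (intro sum_nonneg) auto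
    ultimately have "0 \<le> \<mu> k" "\<mu> k \<le> 1"
      using n k unfolding \<mu>_def by (auto simp: divide_le_eq)
    then have "\<alpha> $ k * \<mu> k \<le> \<alpha> $ k" "0 \<le> \<alpha> $ k * \<mu> k"
      using \<alpha>(1)[OF k] by (auto intro: mult_left_le)
    moreover have "h k G \<in> {0..\<alpha> $ k}"
      unfolding h_def using \<alpha>(1)[OF k] k m by (rule H_mat_row_mean_in_range)
    ultimately show ?thesis using \<alpha>(2)[OF k] c by auto
  qed
  have h_mean: "\<bar>measure_pmf.expectation ?M (h k) - \<alpha> $ k * \<mu> k\<bar> \<le> \<epsilon> + \<delta>" if k: "k < n" for k
  proof -
    have "\<bar>measure_pmf.expectation ?M (h k) - \<alpha> $ k * \<mu> k\<bar> \<le> \<epsilon> + measure_pmf.prob ?M (S k)"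
      using h_good[OF k] h_all[OF k] \<epsilon>
      by (intro abs_expectation_diff_le finite_set_pmf_random_digraph) auto
    then show ?thesis using prob_S[OF k] by linarith
  qed
  have "\<bar>u G i - m i\<bar> \<le> (2 * \<epsilon> + \<delta>) / (1 - c)" if G: "G \<notin> (\<Union>k<n. S k)" for G
  proof (rule substochastic_residual_bound[where d = "\<lambda>k. u G k - m k", OF _ _ c(2) _ i])
    fix k assume k: "k < n"
    show "(\<Sum>j<n. H_mat n \<alpha> G $$ (k, j)) \<le> c"
      using H_mat_row_sum[OF k] \<alpha>(2)[OF k] by simp
    \<comment> \<open>Subtracting the two fixed-point equations cancels the terms in
      \<open>x0\<close> and leaves the fluctuation of the random row applied to
      \<open>m\<close>.\<close>
    have "u G k - m k - (\<Sum>j<n. H_mat n \<alpha> G $$ (k, j) * (u G j - m j))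
      = h k G - measure_pmf.expectation ?M (h k)"
      using u_eq[OF k, of G] m_eq[OF k] by (simp add: h_def right_diff_distrib sum_subtractf)
    then show "\<bar>u G k - m k - (\<Sum>j<n. H_mat n \<alpha> G $$ (k, j) * (u G j - m j))\<bar> \<le> 2 * \<epsilon> + \<delta>"
      using h_good[OF k, of G] h_mean[OF k] G k by auto
  qed (use H_mat_nonneg \<alpha> in auto)
  moreover have "\<bar>u G i - m i\<bar> \<le> 1" for G
    using u[OF i, of G] m[OF i] by auto
  moreover have "0 \<le> (2 * \<epsilon> + \<delta>) / (1 - c)"
    using \<epsilon> c by (auto simp: \<delta>_def intro!: divide_nonneg_nonneg add_nonneg_nonneg)
  ultimately have "\<bar>measure_pmf.expectation ?M (\<lambda>G. u G i) - m i\<bar>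
      \<le> (2 * \<epsilon> + \<delta>) / (1 - c) + measure_pmf.prob ?M (\<Union>k<n. S k)"
    by (intro abs_expectation_diff_le finite_set_pmf_random_digraph)
  moreover have "measure_pmf.prob ?M (\<Union>k<n. S k) \<le> (\<Sum>k<n. measure_pmf.prob ?M (S k))"
    by (rule measure_UNION_le) auto
  moreover have "(\<Sum>k<n. measure_pmf.prob ?M (S k)) \<le> real n * \<delta>"
    using prob_S by (intro sum_bounded_above[of "{..<n}" _ \<delta>, simplified]) auto
  ultimately show ?thesis unfolding u_def m_def by linarith
qed

section \<open>Passage to the limit in the maximum norm\<close>

lemma linf_norm_le:
  assumes "0 \<le> K" "\<And>i. i < dim_vec v \<Longrightarrow> \<bar>v $ i\<bar> \<le> K"
  shows "linf_norm v \<le> K"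
  using assms unfolding linf_norm_def by (subst Max_le_iff) auto

lemma linf_norm_nonneg: "0 \<le> linf_norm v"
  unfolding linf_norm_def by (rule Max_ge) auto

theorem theorem5p2:
  fixes p :: "nat \<Rightarrow> real" and \<alpha> x0 :: "nat \<Rightarrow> real vec" and \<alpha>bar :: real
  assumes p_range: "\<And>n. n \<ge> 1 \<Longrightarrow> 0 < p n \<and> p n < 1"
    and p_growth: "filterlim (\<lambda>n. p n / (ln (real n) / real n)) at_top sequentially"
    and x0_dim: "\<And>n. n \<ge> 1 \<Longrightarrow> x0 n \<in> carrier_vec n"
    and x0_range: "\<And>n i. n \<ge> 1 \<Longrightarrow> i < n \<Longrightarrow> 0 \<le> x0 n $ i \<and> x0 n $ i \<le> 1"
    and \<alpha>_dim: "\<And>n. n \<ge> 1 \<Longrightarrow> \<alpha> n \<in> carrier_vec n"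
    and \<alpha>_range: "\<And>n i. n \<ge> 1 \<Longrightarrow> i < n \<Longrightarrow> 0 \<le> \<alpha> n $ i \<and> \<alpha> n $ i \<le> 1"
    and \<alpha>bar_range: "0 < \<alpha>bar" "\<alpha>bar < 1"
    and \<alpha>_le: "\<And>n i. n \<ge> 1 \<Longrightarrow> i < n \<Longrightarrow> \<alpha> n $ i \<le> \<alpha>bar"
  shows "(\<lambda>n. linf_norm
            (expected_vec n (random_digraph n (p n)) (stable_opinion n (\<alpha> n) (x0 n))
              - stable_mean_field n (p n) (\<alpha> n) (x0 n))) \<longlonglongrightarrow> 0"
proof (rule LIMSEQ_I)
  fix r :: real
  assume r: "0 < r"
  \<comment> \<open>With this choice the contribution 2 \<epsilon> / (1 - \<alpha>bar) is at most
    r/4.\<close>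
  define \<epsilon> where "\<epsilon> = min 1 (r * (1 - \<alpha>bar) / 8)"
  have \<epsilon>: "0 < \<epsilon>" "\<epsilon> \<le> 1" and \<epsilon>_r: "2 * \<epsilon> \<le> r / 4 * (1 - \<alpha>bar)"
    using r \<alpha>bar_range by (auto simp: \<epsilon>_def min_def)
  define \<delta> where "\<delta> n = 2 * exp (- (p n * real (n - 1) * \<epsilon>\<^sup>2 / 32))" for n
  \<comment> \<open>Since n \<le> 2 (n - 1) for n \<ge> 2, the constant 128 makes the exponent p (n
    - 1) \<epsilon>^2 / 32 at least 2 ln n. Hence \<delta> \<le> 2 / n^2, and the union bound over n
    rows costs at most 2 / n.\<close>
  have "eventually (\<lambda>n. 128 / \<epsilon>\<^sup>2 \<le> p n / (ln (real n) / real n)) sequentially"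
    using p_growth by (simp add: filterlim_at_top)
  moreover have "(\<lambda>n. 2 / real n) \<longlonglongrightarrow> 0" by (rule lim_const_over_n)
  then have "eventually (\<lambda>n. 2 / real n < r / 4 * (1 - \<alpha>bar)) sequentially"
    by (rule order_tendstoD) (use r \<alpha>bar_range in auto)
  moreover have "eventually (\<lambda>n. 2 \<le> n) sequentially" by (rule eventually_ge_at_top)
  ultimately have "eventually (\<lambda>n. linf_norm
      (expected_vec n (random_digraph n (p n)) (stable_opinion n (\<alpha> n) (x0 n))
        - stable_mean_field n (p n) (\<alpha> n) (x0 n)) < r) sequentially"
  proof eventually_elim
    case (elim n)
    then have n: "2 \<le> n" "1 \<le> n" by auto
    have ln: "0 < ln (real n)" using n by simp
    have "128 / \<epsilon>\<^sup>2 * ln (real n) \<le> p n * real n"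
      using elim(1) ln n by (simp add: field_simps)
    then have "128 * ln (real n) \<le> p n * real n * \<epsilon>\<^sup>2"
      using \<epsilon> by (simp add: field_simps)
    also have "\<dots> \<le> p n * (2 * real (n - 1)) * \<epsilon>\<^sup>2"
      using p_range[OF n(2)] n by (intro mult_right_mono mult_left_mono) auto
    finally have "2 * ln (real n) \<le> p n * real (n - 1) * \<epsilon>\<^sup>2 / 32" by simp
    then have "\<delta> n \<le> 2 * exp (- (2 * ln (real n)))" by (simp add: \<delta>_def)
    also have "\<dots> = 2 * inverse (exp (ln (real n)) * exp (ln (real n)))"
      by (simp add: exp_minus flip: exp_add)
    also have "\<dots> = 2 / real n / real n" using n by (simp add: field_simps)
    finally have n\<delta>: "real n * \<delta> n \<le> 2 / real n" using n by (simp add: field_simps)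
    have "0 \<le> \<delta> n" by (simp add: \<delta>_def)
    then have "1 * \<delta> n \<le> real n * \<delta> n" using n by (intro mult_right_mono) auto
    then have \<delta>: "\<delta> n \<le> 2 / real n" using n\<delta> by simp
    have "2 * \<epsilon> + \<delta> n \<le> (r / 2) * (1 - \<alpha>bar)"
      using \<epsilon>_r \<delta> elim(2) by (simp add: algebra_simps)
    then have "(2 * \<epsilon> + \<delta> n) / (1 - \<alpha>bar) \<le> r / 2"
      using \<alpha>bar_range by (simp add: pos_divide_le_eq)
    moreover have "r / 4 * (1 - \<alpha>bar) \<le> r / 4 * 1"
      using r \<alpha>bar_range by (intro mult_left_mono) auto
    then have "real n * \<delta> n \<le> r / 4" using n\<delta> elim(2) by simp
    \<comment> \<open>The budget is r/2 for the residual term and r/4 for the union bound; staying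
      at 3/4 r makes the final inequality strict.\<close>
    ultimately have close: "(2 * \<epsilon> + \<delta> n) / (1 - \<alpha>bar) + real n * \<delta> n \<le> 3 / 4 * r" by linarith
    have "linf_norm (expected_vec n (random_digraph n (p n)) (stable_opinion n (\<alpha> n) (x0 n))
        - stable_mean_field n (p n) (\<alpha> n) (x0 n)) \<le> 3 / 4 * r"
    proof (rule linf_norm_le)
      fix i
      assume "i < dim_vec (expected_vec n (random_digraph n (p n)) (stable_opinion n (\<alpha> n) (x0 n))
        - stable_mean_field n (p n) (\<alpha> n) (x0 n))"
      then have i: "i < n" by (simp add: stable_mean_field_def vec_lim_def)
      have "\<bar>measure_pmf.expectation (random_digraph n (p n)) (\<lambda>G. stable_opinion n (\<alpha> n) (x0 n) G $ i)
        - stable_mean_field n (p n) (\<alpha> n) (x0 n) $ i\<bar> \<le> (2 * \<epsilon> + \<delta> n) / (1 - \<alpha>bar) + real n * \<delta> n"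
        unfolding \<delta>_def
        using n p_range[OF n(2)] \<epsilon> \<alpha>_range[OF n(2)] \<alpha>_le[OF n(2)] \<alpha>bar_range x0_dim[OF n(2)]
          x0_range[OF n(2)] i
        by (intro expected_stable_opinion_close) auto
      from order.trans[OF this close]
      show "\<bar>(expected_vec n (random_digraph n (p n)) (stable_opinion n (\<alpha> n) (x0 n))
        - stable_mean_field n (p n) (\<alpha> n) (x0 n)) $ i\<bar> \<le> 3 / 4 * r"
        using i by (simp add: expected_vec_def stable_mean_field_def vec_lim_def)
    qed (use r in simp)
    then show ?case using r by simp
  qed
  then show "\<exists>N. \<forall>n\<ge>N. norm (linf_norm
      (expected_vec n (random_digraph n (p n)) (stable_opinion n (\<alpha> n) (x0 n))
        - stable_mean_field n (p n) (\<alpha> n) (x0 n)) - 0) < r"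
    by (simp add: eventually_sequentially linf_norm_nonneg)
qed

end
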